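(* Let $G$ be a graph, let $S\subseteq V(G)$, and let $k\geq \chi(G)$ be an integer. For a $k$-coloring $\phi$ of $G$ with color classes $C_1,\dots,C_k$ (where $C_i=\phi^{-1}(i)$), let $P_{\phi,S}=(n_1,\dots,n_k)\in\mathbb{R}^k$ with $n_i=|C_i\cap S|$, and let $P_{|S|,k}=\left(\frac{|S|}{k},\dots,\frac{|S|}{k}\right)\in\mathbb{R}^k$. Then a $k$-coloring $\phi$ of $G$ is a $k$-robust coloring of $(G,\overline{G}[S])$ if and only if the Euclidean distance $d(P_{\phi,S},P_{|S|,k})$ is minimum over all $k$-colorings of $G$.
   Context: All graphs are finite, simple and unweighted. $\overline{G}$ is the complement of $G$, $\overline{G}[S]$ is the subgraph of $\overline{G}$ induced by $S$, and $\chi(G)$ is the chromatic number. A $k$-coloring of $G$ is a map $\phi:V(G)\to\{1,\dots,k\}$ with $\phi(u)\neq\phi(v)$ for every edge $uv$ of $G$ (not all colors need to be used). For a subgraph $H$ of $\overline{G}$, an edge $uv$ of $H$ is monochromatic under $\phi$ if $\phi(u)=\phi(v)$. For $k\geq\chi(G)$, $m(G,H,k)$ is the minimum, over all $k$-colorings $\phi$ of $G$, of the number of monochromatic edges of $H$; a $k$-coloring attaining this minimum is called a $k$-robust coloring of $(G,H)$. *)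

theory Defs
  imports "HOL-Analysis.Analysis"
begin

record 'a graph =
  verts :: "'a set"
  edges :: "'a set set"

definition finite_simple_graph :: "'a graph \<Rightarrow> bool" where
  "finite_simple_graph G \<longleftrightarrow>
     finite (verts G) \<and> (\<forall>e\<in>edges G. e \<subseteq> verts G \<and> card e = 2)"

definition complement_graph :: "'a graph \<Rightarrow> 'a graph" where
  "complement_graph G =
     \<lparr> verts = verts G,
       edges = {e. e \<subseteq> verts G \<and> card e = 2 \<and> e \<notin> edges G} \<rparr>"

definition induced_subgraph :: "'a graph \<Rightarrow> 'a set \<Rightarrow> 'a graph" where
  "induced_subgraph G S = \<lparr> verts = S, edges = {e \<in> edges G. e \<subseteq> S} \<rparr>"

text \<open>Values of a coloring outside the vertex set are unconstrained; no notion below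
  depends on them when \<^term>\<open>S \<subseteq> verts G\<close>.\<close>

definition k_coloring :: "'a graph \<Rightarrow> nat \<Rightarrow> ('a \<Rightarrow> nat) \<Rightarrow> bool" where
  "k_coloring G k \<phi> \<longleftrightarrow>
     \<phi> \<in> verts G \<rightarrow> {1..k} \<and> (\<forall>u v. {u, v} \<in> edges G \<longrightarrow> \<phi> u \<noteq> \<phi> v)"

definition chromatic_number :: "'a graph \<Rightarrow> nat" where
  "chromatic_number G = (LEAST k. \<exists>\<phi>. k_coloring G k \<phi>)"

definition monochromatic_edges :: "'a graph \<Rightarrow> ('a \<Rightarrow> nat) \<Rightarrow> 'a set set" where
  "monochromatic_edges H \<phi> = {e \<in> edges H. \<exists>u v. e = {u, v} \<and> \<phi> u = \<phi> v}"

text \<open>The infimum of a nonempty set of natural numbers is its minimum; the set of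
  \<open>k\<close>-colorings is nonempty whenever \<open>k\<close> is at least the chromatic number.\<close>

definition min_monochromatic :: "'a graph \<Rightarrow> 'a graph \<Rightarrow> nat \<Rightarrow> nat" where
  "min_monochromatic G H k =
     (INF \<phi>\<in>{\<phi>. k_coloring G k \<phi>}. card (monochromatic_edges H \<phi>))"

definition k_robust_coloring :: "'a graph \<Rightarrow> 'a graph \<Rightarrow> nat \<Rightarrow> ('a \<Rightarrow> nat) \<Rightarrow> bool" where
  "k_robust_coloring G H k \<phi> \<longleftrightarrow>
     k_coloring G k \<phi> \<and> card (monochromatic_edges H \<phi>) = min_monochromatic G H k"

definition color_class :: "'a graph \<Rightarrow> ('a \<Rightarrow> nat) \<Rightarrow> nat \<Rightarrow> 'a set" where
  "color_class G \<phi> i = {v \<in> verts G. \<phi> v = i}"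

text \<open>Since the dimension \<open>k\<close> is a variable, a point of \<open>\<real>\<^sup>k\<close> is a function
  \<^typ>\<open>nat \<Rightarrow> real\<close> of which only the coordinates \<open>1, \<dots>, k\<close> matter.\<close>

definition euclidean_distance :: "nat \<Rightarrow> (nat \<Rightarrow> real) \<Rightarrow> (nat \<Rightarrow> real) \<Rightarrow> real" where
  "euclidean_distance k x y = L2_set (\<lambda>i. x i - y i) {1..k}"

definition class_size_point :: "'a graph \<Rightarrow> ('a \<Rightarrow> nat) \<Rightarrow> 'a set \<Rightarrow> nat \<Rightarrow> real" where
  "class_size_point G \<phi> S = (\<lambda>i. real (card (color_class G \<phi> i \<inter> S)))"

definition balanced_point :: "nat \<Rightarrow> nat \<Rightarrow> nat \<Rightarrow> real" where
  "balanced_point n k = (\<lambda>i. real n / real k)"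

end

theory Submission
  imports Defs
begin

text \<open>Two equally coloured vertices are never adjacent in \<open>G\<close>, so the monochromatic edges of
  the complement induced on \<open>S\<close> are exactly the pairs inside the sets \<open>C\<^sub>i \<inter> S\<close>; their number is
  \<open>(\<Sum>n\<^sub>i\<^sup>2 - |S|) / 2\<close>. The squared distance is \<open>\<Sum>n\<^sub>i\<^sup>2 - |S|\<^sup>2 / k\<close>. Both are increasing
  functions of \<open>\<Sum>n\<^sub>i\<^sup>2\<close>, hence have the same minimizers.\<close>

lemma real_choose_two: "2 * real (n choose 2) = (real n)\<^sup>2 - real n"
  by (induction n) (auto simp: numeral_2_eq_2 algebra_simps)

lemma monochromatic_edges_complement_induced:
  assumes "S \<subseteq> verts G" and "k_coloring G k \<phi>"
  shows "monochromatic_edges (induced_subgraph (complement_graph G) S) \<phi> =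
    (\<Union>i\<in>{1..k}. {e. e \<subseteq> color_class G \<phi> i \<inter> S \<and> card e = 2})"
    (is "?L = ?R")
proof (intro subset_antisym subsetI)
  fix e assume "e \<in> ?L"
  then obtain u v where e: "e = {u, v}" "\<phi> u = \<phi> v" "e \<subseteq> S" "card e = 2"
    by (auto simp: monochromatic_edges_def induced_subgraph_def complement_graph_def)
  \<comment> \<open>A coloring is confined to \<open>{1..k}\<close> only on \<open>verts G\<close>,
    so this rests on u lying in S and S being contained in \<open>verts G\<close>.\<close>
  then have "\<phi> u \<in> {1..k}"
    using assms by (auto simp: k_coloring_def)
  moreover have "e \<subseteq> color_class G \<phi> (\<phi> u) \<inter> S"
    using e assms(1) by (auto simp: color_class_def)
  ultimately show "e \<in> ?R"
    using e(4) by blast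
next
  fix e assume "e \<in> ?R"
  then obtain i where i: "e \<subseteq> color_class G \<phi> i \<inter> S" "card e = 2"
    by blast
  then obtain u v where uv: "e = {u, v}"
    by (auto simp: card_2_iff)
  have eq: "\<phi> u = \<phi> v"
    using i(1) uv by (auto simp: color_class_def)
  \<comment> \<open>Properness of the coloring turns a pair inside one class into an edge of the
    complement.\<close>
  then have "e \<notin> edges G"
    using assms(2) uv by (auto simp: k_coloring_def)
  then show "e \<in> ?L"
    using i uv eq assms(1)
    by (auto simp: monochromatic_edges_def induced_subgraph_def complement_graph_def)
qed

text \<open>The color classes partition S. This makes every term linear in the class sizes
  independent of the coloring, both in the edge count and in the squared distance.\<close>

lemma sum_class_size_point:
  assumes "finite (verts G)" and "S \<subseteq> verts G" and "k_coloring G k \<phi>"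
  shows "(\<Sum>i\<in>{1..k}. class_size_point G \<phi> S i) = real (card S)"
proof -
  have "S = (\<Union>i\<in>{1..k}. color_class G \<phi> i \<inter> S)"
    using assms(2,3) by (auto simp: color_class_def k_coloring_def)
  then have "card S = card (\<Union>i\<in>{1..k}. color_class G \<phi> i \<inter> S)"
    by simp
  also have "\<dots> = (\<Sum>i\<in>{1..k}. card (color_class G \<phi> i \<inter> S))"
    using assms(1) by (intro card_UN_disjoint) (auto simp: color_class_def)
  finally show ?thesis
    by (simp add: class_size_point_def)
qed

lemma card_monochromatic_edges_complement_induced:
  assumes "finite (verts G)" and "S \<subseteq> verts G" and "k_coloring G k \<phi>"
  shows "2 * real (card (monochromatic_edges (induced_subgraph (complement_graph G) S) \<phi>)) =
    (\<Sum>i\<in>{1..k}. (class_size_point G \<phi> S i)\<^sup>2) - real (card S)"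
proof -
  let ?C = "\<lambda>i. color_class G \<phi> i \<inter> S"
  have fin: "finite (?C i)" for i
    using assms(1) by (simp add: color_class_def)
  \<comment> \<open>A pair is nonempty, and any of its elements determines the color.\<close>
  have disj: "{e. e \<subseteq> ?C i \<and> card e = 2} \<inter> {e. e \<subseteq> ?C j \<and> card e = 2} = {}" if "i \<noteq> j" for i j
    using that by (auto simp: color_class_def card_2_iff)
  have fin_pairs: "finite {e. e \<subseteq> ?C i \<and> card e = 2}" for i
    by (rule finite_subset[OF _ finite_Pow_iff[THEN iffD2, OF fin]]) blast
  have "card (monochromatic_edges (induced_subgraph (complement_graph G) S) \<phi>) =
      (\<Sum>i\<in>{1..k}. card {e. e \<subseteq> ?C i \<and> card e = 2})"
    unfolding monochromatic_edges_complement_induced[OF assms(2,3)]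
    by (intro card_UN_disjoint ballI impI fin_pairs disj finite_atLeastAtMost)
  also have "\<dots> = (\<Sum>i\<in>{1..k}. card (?C i) choose 2)"
    by (intro sum.cong refl n_subsets fin)
  finally have "2 * real (card (monochromatic_edges (induced_subgraph (complement_graph G) S) \<phi>)) =
      (\<Sum>i\<in>{1..k}. (class_size_point G \<phi> S i)\<^sup>2 - class_size_point G \<phi> S i)"
    by (simp add: sum_distrib_left real_choose_two class_size_point_def)
  then show ?thesis
    by (simp only: sum_subtractf sum_class_size_point[OF assms])
qed

text \<open>For \<open>k = 0\<close> both sides are \<open>0\<close>, by the convention \<open>x / 0 = 0\<close>.\<close>

lemma euclidean_distance_balanced_point:
  assumes "finite (verts G)" and "S \<subseteq> verts G" and "k_coloring G k \<phi>"
  shows "(euclidean_distance k (class_size_point G \<phi> S) (balanced_point (card S) k))\<^sup>2 =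
    (\<Sum>i\<in>{1..k}. (class_size_point G \<phi> S i)\<^sup>2) - (real (card S))\<^sup>2 / real k"
proof -
  let ?n = "class_size_point G \<phi> S" and ?a = "real (card S) / real k"
  have "(euclidean_distance k ?n (balanced_point (card S) k))\<^sup>2 = (\<Sum>i\<in>{1..k}. (?n i - ?a)\<^sup>2)"
    by (simp add: euclidean_distance_def L2_set_def balanced_point_def sum_nonneg)
  also have "\<dots> = (\<Sum>i\<in>{1..k}. (?n i)\<^sup>2 - 2 * ?a * ?n i + ?a\<^sup>2)"
    by (intro sum.cong) (auto simp: power2_diff algebra_simps)
  also have "\<dots> = (\<Sum>i\<in>{1..k}. (?n i)\<^sup>2) - 2 * ?a * (\<Sum>i\<in>{1..k}. ?n i) + real k * ?a\<^sup>2"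
    by (simp add: sum.distrib sum_subtractf sum_distrib_left)
  \<comment> \<open>With a = |S|/k, the cross term -2a|S| and the constant ka^2 combine to
    -|S|^2/k.\<close>
  also have "\<dots> = (\<Sum>i\<in>{1..k}. (?n i)\<^sup>2) - (real (card S))\<^sup>2 / real k"
    unfolding sum_class_size_point[OF assms]
    by (cases "k = 0") (auto simp: field_simps power2_eq_square)
  finally show ?thesis .
qed

text \<open>The value at \<phi> belongs to the set of naturals whose infimum is taken, and that set
  is bounded below; so the value equals the infimum exactly when it is a lower bound.\<close>

lemma k_robust_coloring_iff:
  assumes "k_coloring G k \<phi>"
  shows "k_robust_coloring G H k \<phi> \<longleftrightarrow> (\<forall>\<psi>. k_coloring G k \<psi> \<longrightarrow>
    card (monochromatic_edges H \<phi>) \<le> card (monochromatic_edges H \<psi>))"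
proof -
  let ?M = "(\<lambda>\<phi>. card (monochromatic_edges H \<phi>)) ` {\<phi>. k_coloring G k \<phi>}"
  have mem: "card (monochromatic_edges H \<phi>) \<in> ?M"
    using assms by blast
  have "card (monochromatic_edges H \<phi>) = Inf ?M \<longleftrightarrow> (\<forall>m\<in>?M. card (monochromatic_edges H \<phi>) \<le> m)"
    using mem by (metis bdd_below_bot cInf_eq_minimum cInf_lower)
  then show ?thesis
    using assms by (auto simp: k_robust_coloring_def min_monochromatic_def)
qed

theorem theorem1:
  fixes G :: "'a graph" and S :: "'a set" and k :: nat and \<phi> :: "'a \<Rightarrow> nat"
  assumes "finite_simple_graph G"
    and "S \<subseteq> verts G"
    and "k \<ge> chromatic_number G"
    and "k_coloring G k \<phi>"
  shows "k_robust_coloring G (induced_subgraph (complement_graph G) S) k \<phi> \<longleftrightarrow>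
    (\<forall>\<psi>. k_coloring G k \<psi> \<longrightarrow>
       euclidean_distance k (class_size_point G \<phi> S) (balanced_point (card S) k)
       \<le> euclidean_distance k (class_size_point G \<psi> S) (balanced_point (card S) k))"
proof -
  let ?H = "induced_subgraph (complement_graph G) S"
  let ?d = "\<lambda>\<psi>. euclidean_distance k (class_size_point G \<psi> S) (balanced_point (card S) k)"
  have fin: "finite (verts G)"
    using assms(1) by (simp add: finite_simple_graph_def)
  have "card (monochromatic_edges ?H \<phi>) \<le> card (monochromatic_edges ?H \<psi>) \<longleftrightarrow> ?d \<phi> \<le> ?d \<psi>"
    if "k_coloring G k \<psi>" for \<psi>
  proof -
    \<comment> \<open>Distances are nonnegative, so squaring preserves and reflects their
      order.\<close>
    have "?d \<phi> \<le> ?d \<psi> \<longleftrightarrow> (?d \<phi>)\<^sup>2 \<le> (?d \<psi>)\<^sup>2"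
      by (simp add: euclidean_distance_def)
    \<comment> \<open>The offsets |S| and |S|^2/k are the same for both colorings, so each
      inequality reduces to comparing the sums of squared class sizes.\<close>
    then show ?thesis
      using euclidean_distance_balanced_point[OF fin assms(2,4)]
        euclidean_distance_balanced_point[OF fin assms(2) that]
        card_monochromatic_edges_complement_induced[OF fin assms(2,4)]
        card_monochromatic_edges_complement_induced[OF fin assms(2) that]
      by linarith
  qed
  then show ?thesis
    unfolding k_robust_coloring_iff[OF assms(4)] by blast
qed

end
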